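(* Let $A\in\mathbb{R}^{n\times n}$ and $c\in\mathbb{R}^{1\times n}$ be such that $(A,c)$ is observable, and let $k\in\{1,\dots,n\}$. For $r\in\{1,\dots,k\}$ and $\beta\in\mathcal{I}_{n,r}$ define $P_\beta := I_{\{1,\dots,n\},\beta}\in\mathbb{R}^{n\times r}$ (the columns of the identity matrix $I\in\mathbb{R}^{n\times n}$ with indices in $\beta$), $\tilde A_r:=A_{[r]}$, $\tilde c_r:=\left(\mathcal{O}^r\right)_{[r]}$ and $$\tilde b_{r,r,\beta}:=\left(\left(\mathcal{O}^n\right)^{-1}\right)_{[r]}\left(\mathcal{O}^nP_\beta\right)_{[r]}.$$ Suppose that (i) $(\tilde A_r,\tilde b_{r,r,\beta},\tilde c_r)$ is strictly externally positive for all $r\in\{1,\dots,k-1\}$ and all $\beta\in\mathcal{I}_{n,r}$; (ii) $(\tilde A_k,\tilde b_{k,k,\beta},\tilde c_k)$ is externally positive (respectively, strictly externally positive) for all $\beta\in\mathcal{I}_{n,k}$. Then the observability operator $\mathcal{O}$ of $(A,c)$ is $k$-positive (respectively, strictly $k$-positive).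
   Context: Observability: for $A\in\mathbb{R}^{n\times n}$, $c\in\mathbb{R}^{1\times n}$, the observability operator $\mathcal{O}=\mathcal{O}(A,c):\mathbb{R}^n\to\mathbb{R}^{\mathbb{Z}_{\ge 0}}$ is $(\mathcal{O}x_0)(t):=cA^tx_0$, $t\ge 0$. For $t\ge1$, $\mathcal{O}^t\in\mathbb{R}^{t\times n}$ is the matrix with rows $c, cA,\dots,cA^{t-1}$ (in this order). $(A,c)$ is observable if $\mathcal{O}^n$ is invertible. $\mathcal{I}_{n,r}$ is the set of $r$-element subsets of $\{1,\dots,n\}$, listed increasingly. For $X\in\mathbb{R}^{p\times q}$ and $1\le r\le\min\{p,q\}$, $X_{[r]}\in\mathbb{R}^{\binom{p}{r}\times\binom{q}{r}}$ is the $r$-th multiplicative compound matrix: its entries are the $r\times r$ minors $\det X_{I,J}$, with $I\in\mathcal{I}_{p,r}$, $J\in\mathcal{I}_{q,r}$ ordered lexicographically. A matrix $X\in\mathbb{R}^{p\times q}$ with $k\le\min\{p,q\}$ is $k$-positive (strictly $k$-positive) if all its $j\times j$ minors are nonnegative (positive) for every $j\in\{1,\dots,k\}$. The operator $\mathcal{O}$ is called (strictly) $k$-positive if $\mathcal{O}^t$ is (strictly) $k$-positive for all $t\ge k$. A triple $(\tilde A,\tilde b,\tilde c)$ (square matrix, column vector, row vector of compatible sizes) is externally positive if $\tilde c\tilde A^{t-1}\tilde b\ge0$ for all integers $t\ge1$, and strictly externally positive if $\tilde c\tilde A^{t-1}\tilde b>0$ for all integers $t\ge1$. *)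

theory Defs
  imports
    Complex_Main
    "Jordan_Normal_Form.Determinant"
    "Jordan_Normal_Form.DL_Submatrix"
    "Jordan_Normal_Form.Gauss_Jordan_Elimination"
begin

text \<open>Row, column and time indices are numbered from 0, as in the matrix library.\<close>

definition index_sets :: "nat \<Rightarrow> nat \<Rightarrow> nat set set" where
  "index_sets n r = {I. I \<subseteq> {0..<n} \<and> card I = r}"

text \<open>
  The increasing sequences of length \<open>r\<close> over \<open>{0..<n}\<close> in lexicographic order; the
  lemmas below show that this is what filtering \<^const>\<open>subseqs\<close> yields.
\<close>

definition index_seqs :: "nat \<Rightarrow> nat \<Rightarrow> nat list list" where
  "index_seqs n r = filter (\<lambda>xs. length xs = r) (subseqs [0..<n])"

definition index_list :: "nat \<Rightarrow> nat \<Rightarrow> nat set list" where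
  "index_list n r = map set (index_seqs n r)"

lemma subseqs_strict_sorted:
  "sorted_wrt (<) xs \<Longrightarrow> ys \<in> set (subseqs xs) \<Longrightarrow> sorted_wrt (<) (ys :: nat list)"
proof (induction xs arbitrary: ys)
  case Nil
  then show ?case by simp
next
  case (Cons x xs)
  have sub: "set zs \<subseteq> set xs" if "zs \<in> set (subseqs xs)" for zs
    using that subseqs_powset[of xs] by blast
  from Cons.prems(2) consider "ys \<in> set (subseqs xs)"
    | zs where "ys = x # zs" "zs \<in> set (subseqs xs)"
    by (auto simp: Let_def)
  then show ?case
    using Cons.IH Cons.prems(1) sub by cases auto
qed

lemma sorted_subseqs_lex:
  fixes xs :: "nat list"
  assumes "sorted_wrt (<) xs"
  shows "sorted_wrt (\<lambda>us vs. (us, vs) \<in> lex less_than)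
           (filter (\<lambda>ys. length ys = r) (subseqs xs))"
  using assms
proof (induction xs arbitrary: r)
  case Nil
  then show ?case by simp
next
  case (Cons x xs)
  have sub: "set zs \<subseteq> set xs" if "zs \<in> set (subseqs xs)" for zs
    using that subseqs_powset[of xs] by blast
  have less: "x < y" if "y \<in> set xs" for y
    using Cons.prems that by simp
  show ?case
  proof (cases r)
    case 0
    have "filter (\<lambda>ys. length ys = 0) (map ((#) x) (subseqs xs)) = []"
      by (simp add: filter_empty_conv)
    then show ?thesis
      using Cons.IH[of 0] Cons.prems 0 by (simp add: Let_def)
  next
    case (Suc s)
    have eq: "filter (\<lambda>ys. length ys = r) (map ((#) x) (subseqs xs))
        = map ((#) x) (filter (\<lambda>ys. length ys = s) (subseqs xs))"
      by (simp add: filter_map o_def Suc)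
    have cross: "(x # us, vs) \<in> lex less_than"
      if h: "length us = s" "vs \<in> set (subseqs xs)" "length vs = r" for us vs
    proof -
      obtain y ys where vs: "vs = y # ys"
        using h(3) Suc by (cases vs) auto
      then have "y \<in> set xs"
        using h(2) sub[of vs] by simp
      then have "x < y" "length us = length ys"
        using h vs less Suc by simp_all
      then show ?thesis by (simp add: vs)
    qed
    have tail: "sorted_wrt (\<lambda>us vs. (us, vs) \<in> lex less_than)
        (map ((#) x) (filter (\<lambda>ys. length ys = s) (subseqs xs)))"
      unfolding sorted_wrt_map
      by (rule sorted_wrt_mono_rel[OF _ Cons.IH]) (use Cons.prems in auto)
    show ?thesis
      using Cons.IH[of r] Cons.prems cross tail
      by (auto simp: Let_def eq sorted_wrt_append)
  qed
qed

lemma index_seqs_lex: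
  "sorted_wrt (\<lambda>us vs. (us, vs) \<in> lex less_than) (index_seqs n r)"
  unfolding index_seqs_def by (rule sorted_subseqs_lex) simp

lemma index_seqs_strict_sorted: "xs \<in> set (index_seqs n r) \<Longrightarrow> sorted_wrt (<) xs"
  unfolding index_seqs_def using subseqs_strict_sorted[of "[0..<n]" xs] by simp

lemma set_index_list: "set (index_list n r) = index_sets n r"
proof (intro Set.set_eqI iffI)
  fix I assume "I \<in> set (index_list n r)"
  then obtain xs where xs: "xs \<in> set (index_seqs n r)" "I = set xs"
    by (auto simp: index_list_def)
  then have "set xs \<in> Pow {0..<n}" "length xs = r"
    using subseqs_powset[of "[0..<n]"] by (auto simp: index_seqs_def)
  moreover have "distinct xs"
    using index_seqs_strict_sorted[OF xs(1)] strict_sorted_iff by blast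
  ultimately show "I \<in> index_sets n r"
    using xs(2) distinct_card[of xs] by (simp add: index_sets_def)
next
  fix I assume I: "I \<in> index_sets n r"
  then have "I \<in> set ` set (subseqs [0..<n])"
    by (simp add: subseqs_powset index_sets_def)
  then obtain xs where xs: "xs \<in> set (subseqs [0..<n])" "I = set xs"
    by blast
  have "distinct xs"
    using subseqs_strict_sorted[OF _ xs(1)] strict_sorted_iff by auto
  then have "length xs = r"
    using I xs(2) distinct_card[of xs] by (simp add: index_sets_def)
  then show "I \<in> set (index_list n r)"
    using xs by (auto simp: index_list_def index_seqs_def)
qed

lemma distinct_index_list: "distinct (index_list n r)"
  unfolding index_list_def index_seqs_def
  using distinct_set_subseqs[of "[0..<n]"]
  by (simp add: distinct_map inj_on_def)

lemma length_index_list: "length (index_list n r) = n choose r"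
proof -
  have "length (index_list n r) = card (index_sets n r)"
    using distinct_card[OF distinct_index_list[of n r]] by (simp add: set_index_list)
  then show ?thesis
    by (simp add: index_sets_def n_subsets)
qed

definition compound :: "nat \<Rightarrow> 'a :: comm_ring_1 mat \<Rightarrow> 'a mat" where
  "compound r X = mat (dim_row X choose r) (dim_col X choose r)
     (\<lambda>(i, j). det (submatrix X (index_list (dim_row X) r ! i) (index_list (dim_col X) r ! j)))"

definition k_positive :: "nat \<Rightarrow> real mat \<Rightarrow> bool" where
  "k_positive k X \<longleftrightarrow> k \<le> min (dim_row X) (dim_col X) \<and>
     (\<forall>j\<in>{1..k}. \<forall>I\<in>index_sets (dim_row X) j. \<forall>J\<in>index_sets (dim_col X) j.
        det (submatrix X I J) \<ge> 0)"

definition strictly_k_positive :: "nat \<Rightarrow> real mat \<Rightarrow> bool" where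
  "strictly_k_positive k X \<longleftrightarrow> k \<le> min (dim_row X) (dim_col X) \<and>
     (\<forall>j\<in>{1..k}. \<forall>I\<in>index_sets (dim_row X) j. \<forall>J\<in>index_sets (dim_col X) j.
        det (submatrix X I J) > 0)"

text \<open>Row vectors are matrices with one row, column vectors are matrices with one column.\<close>

definition externally_positive :: "real mat \<Rightarrow> real mat \<Rightarrow> real mat \<Rightarrow> bool" where
  "externally_positive A b c \<longleftrightarrow> (\<forall>t\<ge>1. (c * A ^\<^sub>m (t - 1) * b) $$ (0, 0) \<ge> 0)"

definition strictly_externally_positive :: "real mat \<Rightarrow> real mat \<Rightarrow> real mat \<Rightarrow> bool" where
  "strictly_externally_positive A b c \<longleftrightarrow> (\<forall>t\<ge>1. (c * A ^\<^sub>m (t - 1) * b) $$ (0, 0) > 0)"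

definition obs_op :: "real mat \<Rightarrow> real mat \<Rightarrow> real vec \<Rightarrow> nat \<Rightarrow> real" where
  "obs_op A c x t = ((c * A ^\<^sub>m t) *\<^sub>v x) $ 0"

definition obs_mat :: "real mat \<Rightarrow> real mat \<Rightarrow> nat \<Rightarrow> real mat" where
  "obs_mat A c t = mat_of_rows (dim_row A) (map (\<lambda>i. row (c * A ^\<^sub>m i) 0) [0..<t])"

text \<open>The matrices \<^const>\<open>obs_mat\<close> represent the truncations of the operator \<^const>\<open>obs_op\<close>.\<close>

lemma obs_mat_mult_vec:
  assumes "A \<in> carrier_mat n n" "c \<in> carrier_mat 1 n" "i < t"
  shows "(obs_mat A c t *\<^sub>v x) $ i = obs_op A c x i"
proof -
  have "row (c * A ^\<^sub>m i) 0 \<in> carrier_vec n"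
    using row_carrier[of "c * A ^\<^sub>m i" 0] assms(1) by (simp split: if_splits)
  then have "row (obs_mat A c t) i = row (c * A ^\<^sub>m i) 0"
    unfolding obs_mat_def using assms by (subst mat_of_rows_row) auto
  then show ?thesis
    using assms by (simp add: obs_op_def) (simp add: obs_mat_def)
qed

definition observable :: "real mat \<Rightarrow> real mat \<Rightarrow> bool" where
  "observable A c \<longleftrightarrow> invertible_mat (obs_mat A c (dim_row A))"

definition obs_op_k_positive :: "nat \<Rightarrow> real mat \<Rightarrow> real mat \<Rightarrow> bool" where
  "obs_op_k_positive k A c \<longleftrightarrow> (\<forall>t\<ge>k. k_positive k (obs_mat A c t))"

definition obs_op_strictly_k_positive :: "nat \<Rightarrow> real mat \<Rightarrow> real mat \<Rightarrow> bool" where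
  "obs_op_strictly_k_positive k A c \<longleftrightarrow> (\<forall>t\<ge>k. strictly_k_positive k (obs_mat A c t))"

definition col_selector :: "nat \<Rightarrow> nat set \<Rightarrow> real mat" where
  "col_selector n \<beta> = submatrix (1\<^sub>m n) {0..<n} \<beta>"

text \<open>
  The library function \<^const>\<open>mat_inverse\<close> is partial; for invertible matrices
  it returns the two-sided inverse.
\<close>

lemma mat_inverse_invertible:
  fixes X :: "'a :: field mat"
  assumes "X \<in> carrier_mat n n" "invertible_mat X"
  shows "the (mat_inverse X) \<in> carrier_mat n n"
    "X * the (mat_inverse X) = 1\<^sub>m n" "the (mat_inverse X) * X = 1\<^sub>m n"
proof -
  obtain B where B: "X * B = 1\<^sub>m n" "B * X = 1\<^sub>m (dim_row B)"
    using assms by (auto simp: invertible_mat_def inverts_mat_def)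
  have "dim_col B = n" "dim_row B = n"
    using B assms(1) index_one_mat(3) index_mult_mat(3) carrier_matD(2) by metis+
  then have "X \<in> Units (ring_mat TYPE('a) n ())"
    using B assms(1) by (auto simp: Units_def ring_mat_def)
  then obtain C where "mat_inverse X = Some C"
    using mat_inverse(1)[OF assms(1), of "()"] by (cases "mat_inverse X") auto
  then show "the (mat_inverse X) \<in> carrier_mat n n"
    "X * the (mat_inverse X) = 1\<^sub>m n" "the (mat_inverse X) * X = 1\<^sub>m n"
    using mat_inverse(2)[OF assms(1)] by auto
qed

definition A_tilde :: "real mat \<Rightarrow> nat \<Rightarrow> real mat" where
  "A_tilde A r = compound r A"

definition c_tilde :: "real mat \<Rightarrow> real mat \<Rightarrow> nat \<Rightarrow> real mat" where
  "c_tilde A c r = compound r (obs_mat A c r)"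

definition b_tilde :: "real mat \<Rightarrow> real mat \<Rightarrow> nat \<Rightarrow> nat set \<Rightarrow> real mat" where
  "b_tilde A c r \<beta> = (let n = dim_row A; M = obs_mat A c n in
     compound r (the (mat_inverse M)) * compound r (M * col_selector n \<beta>))"

end

theory Submission
  imports Defs
begin

text \<open>
  By Cauchy--Binet, compounds are multiplicative. The compounds of \<open>\<O>\<^sup>n\<close> and of its
  inverse inside \<^const>\<open>b_tilde\<close> therefore cancel, and the \<open>s\<close>-th Markov parameter of the
  triple belonging to \<open>r\<close> and \<open>\<beta>\<close> is the determinant of \<open>\<O>\<^sup>r A\<^sup>s P\<^sub>\<beta>\<close>. The rows of
  \<open>\<O>\<^sup>r A\<^sup>s\<close> are \<open>c A\<^sup>s, \<dots>, c A\<^sup>s\<^sup>+\<^sup>r\<^sup>-\<^sup>1\<close>, so this is the minor of the infinite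
  observability matrix on the \<open>r\<close> consecutive rows from \<open>s\<close> on and the columns \<open>\<beta>\<close>
  (\<open>markov_parameter_eq_minor\<close>). The hypotheses thus say exactly that all minors with
  consecutive rows are positive up to order \<open>k - 1\<close>, and nonnegative or positive in order \<open>k\<close>.

  What remains is a Fekete-type statement (\<open>minors_from_consecutive\<close>): consecutive rows suffice.
  Suppose that the minors of order \<open>r - 1\<close> are positive, and let rows \<open>a < \<dots> < b\<close> of an
  order-\<open>r\<close> minor skip a row \<open>p\<close> between \<open>a\<close> and \<open>b\<close>. The three-term Pluecker relation
  (\<open>three_term_relation\<close>) writes this minor, times a minor of order \<open>r - 1\<close>, as a combination
  of two order-\<open>r\<close> minors, in which \<open>p\<close> replaces \<open>b\<close> or \<open>a\<close>, with minors of order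
  \<open>r - 1\<close> as coefficients. Both have a shorter row span, so induction on the span reduces to
  consecutive rows. Only divisors of order \<open>r - 1\<close> occur, which is why positivity below order
  \<open>k\<close> is enough to propagate mere nonnegativity in order \<open>k\<close> itself.
\<close>

section \<open>Minors indexed by lists\<close>

text \<open>
  Rows and columns are given by lists rather than sets, so that they may be repeated or out of
  order; the proof of the Pluecker relation uses both.
\<close>

definition minor :: "('a \<Rightarrow> 'b \<Rightarrow> 'c :: comm_ring_1) \<Rightarrow> 'a list \<Rightarrow> 'b list \<Rightarrow> 'c" where
  "minor M xs ys = det (mat (length xs) (length ys) (\<lambda>(a, b). M (xs ! a) (ys ! b)))"

definition remove_nth :: "nat \<Rightarrow> 'a list \<Rightarrow> 'a list" where
  "remove_nth i xs = take i xs @ drop (Suc i) xs"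

lemma length_remove_nth: "i < length xs \<Longrightarrow> length (remove_nth i xs) = length xs - 1"
  by (simp add: remove_nth_def)

lemma nth_remove_nth:
  "i < length xs \<Longrightarrow> a < length xs - 1 \<Longrightarrow> remove_nth i xs ! a = xs ! (if a < i then a else Suc a)"
  by (auto simp: remove_nth_def nth_append min_def)

lemma remove_nth_append: "remove_nth (length xs) (xs @ y # zs) = xs @ zs"
  by (simp add: remove_nth_def)

text \<open>This turns Laplace expansion into a recursion on the lists of rows and columns.\<close>

lemma cofactor_eq_minor:
  fixes M :: "'a \<Rightarrow> 'b \<Rightarrow> 'c :: comm_ring_1"
  assumes "length xs = length ys" "i < length xs" "j < length ys"
  shows "cofactor (mat (length ys) (length ys) (\<lambda>(a, b). M (xs ! a) (ys ! b))) i j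
    = (-1) ^ (i + j) * minor M (remove_nth i xs) (remove_nth j ys)"
proof -
  have "mat_delete (mat (length ys) (length ys) (\<lambda>(a, b). M (xs ! a) (ys ! b))) i j
    = mat (length (remove_nth i xs)) (length (remove_nth j ys))
        (\<lambda>(a, b). M (remove_nth i xs ! a) (remove_nth j ys ! b))"
    using assms by (auto simp: mat_delete_def nth_remove_nth length_remove_nth intro!: eq_matI)
  then show ?thesis
    by (simp add: cofactor_def minor_def)
qed

lemma minor_expand_row:
  assumes "length xs = length ys" "i < length xs"
  shows "minor M xs ys = (\<Sum>j<length ys. (-1) ^ (i + j) * M (xs ! i) (ys ! j)
           * minor M (remove_nth i xs) (remove_nth j ys))"
proof -
  let ?A = "mat (length xs) (length ys) (\<lambda>(a, b). M (xs ! a) (ys ! b))"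
  have "minor M xs ys = (\<Sum>j<length ys. ?A $$ (i, j) * cofactor ?A i j)"
    unfolding minor_def by (rule laplace_expansion_row) (use assms in auto)
  also have "\<dots> = (\<Sum>j<length ys. (-1) ^ (i + j) * M (xs ! i) (ys ! j)
           * minor M (remove_nth i xs) (remove_nth j ys))"
    using assms by (intro sum.cong) (simp_all add: cofactor_eq_minor mult_ac)
  finally show ?thesis .
qed

lemma minor_expand_column:
  assumes "length xs = length ys" "j < length ys"
  shows "minor M xs ys = (\<Sum>i<length xs. (-1) ^ (i + j) * M (xs ! i) (ys ! j)
           * minor M (remove_nth i xs) (remove_nth j ys))"
proof -
  let ?A = "mat (length xs) (length ys) (\<lambda>(a, b). M (xs ! a) (ys ! b))"
  have "minor M xs ys = (\<Sum>i<length xs. ?A $$ (i, j) * cofactor ?A i j)"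
    unfolding minor_def by (rule laplace_expansion_column) (use assms in auto)
  also have "\<dots> = (\<Sum>i<length xs. (-1) ^ (i + j) * M (xs ! i) (ys ! j)
           * minor M (remove_nth i xs) (remove_nth j ys))"
    using assms by (intro sum.cong) (simp_all add: cofactor_eq_minor mult_ac)
  finally show ?thesis .
qed

lemma minor_repeated_row:
  assumes "length xs = length ys" "\<not> distinct xs"
  shows "minor M xs ys = 0"
proof -
  obtain i j where "i < length xs" "j < length xs" "i \<noteq> j" "xs ! i = xs ! j"
    using assms(2) by (auto simp: distinct_conv_nth)
  then show ?thesis
    unfolding minor_def using assms(1)
    by (intro det_identical_rows[of _ "length ys" i j]) auto
qed

lemma minor_repeated_column:
  assumes "length xs = length ys" "\<not> distinct ys"
  shows "minor M xs ys = 0"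
proof -
  obtain i j where "i < length ys" "j < length ys" "i \<noteq> j" "ys ! i = ys ! j"
    using assms(2) by (auto simp: distinct_conv_nth)
  then show ?thesis
    unfolding minor_def using assms(1)
    by (intro det_identical_columns[of _ "length ys" i j]) auto
qed

lemma minor_move_row_to_front:
  assumes "length (us @ p # vs) = length ys"
  shows "minor M (us @ p # vs) ys = (-1) ^ length us * minor M (p # us @ vs) ys"
proof -
  have "minor M (us @ p # vs) ys = (\<Sum>j<length ys. (-1) ^ (length us + j) * M p (ys ! j)
      * minor M (us @ vs) (remove_nth j ys))"
    using minor_expand_row[of "us @ p # vs" ys "length us" M] assms
    by (simp add: remove_nth_append)
  also have "\<dots> = (-1) ^ length us * (\<Sum>j<length ys. (-1) ^ j * M p (ys ! j)
      * minor M (us @ vs) (remove_nth j ys))"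
    by (simp add: sum_distrib_left power_add mult.assoc)
  also have "(\<Sum>j<length ys. (-1) ^ j * M p (ys ! j) * minor M (us @ vs) (remove_nth j ys))
    = minor M (p # us @ vs) ys"
    using minor_expand_row[of "p # us @ vs" ys 0 M] assms
    by (cases ys) (simp_all add: remove_nth_def)
  finally show ?thesis .
qed

text \<open>
  Cramer's rule: the \<open>n + 1\<close> rows \<open>xs\<close> in an \<open>n\<close>-dimensional space satisfy the linear relation
  whose coefficients are the alternating minors with one row left out, because for every column
  the left-hand side is the expansion of a determinant in which that column occurs twice. Here the
  linear functional \<open>x \<mapsto> minor M (x # ts) zs\<close> is applied to this relation.
\<close>

lemma cramer_relation:
  assumes "length xs = Suc (length ys)" "length ts = length zs - 1" "zs \<noteq> []" "set zs \<subseteq> set ys"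
  shows "(\<Sum>i<length xs. (-1) ^ i * minor M (xs ! i # ts) zs * minor M (remove_nth i xs) ys) = 0"
proof -
  let ?C = "\<lambda>b. (-1) ^ b * minor M ts (remove_nth b zs)"
  have row: "minor M (x # ts) zs = (\<Sum>b<length zs. M x (zs ! b) * ?C b)" for x
    using assms minor_expand_row[of "x # ts" zs 0 M]
    by (cases zs) (simp_all add: remove_nth_def mult_ac)
  have col: "(\<Sum>i<length xs. (-1) ^ i * M (xs ! i) y * minor M (remove_nth i xs) ys) = 0"
    if "y \<in> set ys" for y
    using minor_expand_column[of xs "y # ys" 0 M] minor_repeated_column[of xs "y # ys" M] that assms(1)
    by (simp add: remove_nth_def)
  have "(\<Sum>i<length xs. (-1) ^ i * minor M (xs ! i # ts) zs * minor M (remove_nth i xs) ys)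
    = (\<Sum>i<length xs. \<Sum>b<length zs.
        ?C b * ((-1) ^ i * M (xs ! i) (zs ! b) * minor M (remove_nth i xs) ys))"
    by (simp add: row sum_distrib_left sum_distrib_right mult_ac)
  also have "\<dots> = (\<Sum>b<length zs. ?C b *
        (\<Sum>i<length xs. (-1) ^ i * M (xs ! i) (zs ! b) * minor M (remove_nth i xs) ys))"
    by (subst sum.swap) (simp add: sum_distrib_left)
  also have "\<dots> = 0"
    using assms(4) by (intro sum.neutral ballI) (simp add: col subset_iff)
  finally show ?thesis .
qed

text \<open>
  For the rows \<open>a, us, p, vs, b\<close> and the functional \<open>x \<mapsto> minor M (x # us @ vs) zs\<close>, which
  vanishes on the rows in \<open>us\<close> and \<open>vs\<close>, only three terms of Cramer's relation survive. Moving
  \<open>x\<close> from the front to its place in the row order costs a sign; together with the alternating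
  signs of the relation, this leaves \<open>a\<close> and \<open>b\<close> with sign \<open>+\<close> and \<open>p\<close> with sign \<open>-\<close>.
\<close>

lemma three_term_relation:
  fixes M :: "'a \<Rightarrow> 'b \<Rightarrow> 'c :: comm_ring_1"
  assumes "length ys = length us + length vs + 2" "length zs = length us + length vs + 1"
    "set zs \<subseteq> set ys"
  shows "minor M (us @ p # vs) zs * minor M (a # us @ vs @ [b]) ys
    = minor M (us @ vs @ [b]) zs * minor M (a # us @ p # vs) ys
    + minor M (a # us @ vs) zs * minor M (us @ p # vs @ [b]) ys"
proof -
  define ks where "ks = a # us @ p # vs @ [b]"
  define q l where "q = length (a # us)" and "l = length (a # us @ p # vs)"
  define f where "f i = (-1) ^ i * minor M (ks ! i # us @ vs) zs * minor M (remove_nth i ks) ys" for i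
  have k0: "ks ! 0 = a" "remove_nth 0 ks = us @ p # vs @ [b]"
    by (simp_all add: ks_def remove_nth_def)
  have kq: "ks ! q = p" "remove_nth q ks = a # us @ vs @ [b]"
    using remove_nth_append[of "a # us" p "vs @ [b]"]
    by (simp_all add: ks_def q_def)
  have kl: "ks ! l = b" "remove_nth l ks = a # us @ p # vs"
    using remove_nth_append[of "a # us @ p # vs" b "[]"]
    by (simp_all add: ks_def l_def nth_append)
  \<comment> \<open>At the other positions a row of \<open>us @ vs\<close> is repeated.\<close>
  have mid: "f i = 0" if i: "i < length ks" "i \<notin> {0, q, l}" for i
  proof -
    have "ks ! i \<in> set (us @ vs)"
    proof -
      obtain i' where i': "i = Suc i'"
        using i(2) by (cases i) auto
      have 1: "i' < length us \<or> length us < i' \<and> i' - Suc (length us) < length vs"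
        using i unfolding i' q_def l_def ks_def by auto
      then show ?thesis
        by (auto simp: ks_def i' nth_append nth_Cons split: nat.split)
    qed
    then show ?thesis
      using assms minor_repeated_row[of "ks ! i # us @ vs" zs M] by (simp add: f_def)
  qed
  have "zs \<noteq> []" "length ks = Suc (length ys)"
    using assms by (auto simp: ks_def)
  then have "0 = sum f {..<length ks}"
    unfolding f_def using cramer_relation[of ks ys "us @ vs" zs M] assms by simp
  also have "\<dots> = sum f {0, q, l}"
    by (rule sum.mono_neutral_right) (use mid in \<open>auto simp: ks_def q_def l_def\<close>)
  also have "\<dots> = f 0 + f q + f l"
    by (simp add: q_def l_def)
  finally have "f 0 + f q + f l = 0" by simp
  moreover have "f 0 = minor M (a # us @ vs) zs * minor M (us @ p # vs @ [b]) ys"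
    by (simp add: f_def k0)
  moreover have "f q = - (minor M (us @ p # vs) zs * minor M (a # us @ vs @ [b]) ys)"
    unfolding f_def kq using minor_move_row_to_front[of us p vs zs M] assms
    by (simp add: q_def)
  moreover have "f l = minor M (us @ vs @ [b]) zs * minor M (a # us @ p # vs) ys"
    unfolding f_def kl using minor_move_row_to_front[of "us @ vs" b "[]" zs M] assms
    by (simp add: l_def)
  ultimately show ?thesis
    by (simp add: algebra_simps)
qed

section \<open>Consecutive rows decide the sign of all minors\<close>

lemma consecutive_or_gap:
  fixes xs :: "nat list"
  assumes "sorted_wrt (<) xs" "length xs = Suc r"
  obtains s where "xs = [s..<s + Suc r]"
  | a us p vs b where "xs = a # us @ vs @ [b]" "sorted_wrt (<) (a # us @ p # vs @ [b])"
proof (cases "\<forall>p. hd xs < p \<and> p < last xs \<longrightarrow> p \<in> set xs")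
  case True
  have ne: "xs \<noteq> []" using assms by auto
  have ends: "hd xs \<le> x \<and> x \<le> last xs" if "x \<in> set xs" for x
    using that assms(1) ne
    by (metis UnE empty_iff hd_Cons_tl le_refl less_imp_le list.set(1) list.set_intros(1)
        set_ConsD set_append snoc_eq_iff_butlast sorted_wrt.simps(2) sorted_wrt_append)
  have "set xs = set [hd xs..<Suc (last xs)]"
  proof
    show "set xs \<subseteq> set [hd xs..<Suc (last xs)]"
      using ends by (auto simp: less_Suc_eq_le simp del: upt_Suc)
    show "set [hd xs..<Suc (last xs)] \<subseteq> set xs"
    proof
      fix x assume "x \<in> set [hd xs..<Suc (last xs)]"
      then have "x = hd xs \<or> x = last xs \<or> hd xs < x \<and> x < last xs"
        by (auto simp del: upt_Suc)
      then show "x \<in> set xs" using True ne by auto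
    qed
  qed
  then have eq: "xs = [hd xs..<Suc (last xs)]"
    using assms(1)
    by (intro sorted_distinct_set_unique) (simp_all add: strict_sorted_iff del: upt_Suc)
  then have "length xs = Suc (last xs) - hd xs"
    by (metis length_upt)
  then have "Suc (last xs) = hd xs + Suc r"
    using assms(2) by simp
  then show ?thesis
    using that(1)[of "hd xs"] eq by metis
next
  case False
  then obtain p where p: "hd xs < p" "p < last xs" "p \<notin> set xs" by blast
  have ne: "xs \<noteq> []" using assms by auto
  \<comment> \<open>The gap \<open>p\<close> splits \<open>xs\<close> into two parts, neither of which is empty.\<close>
  define us vs where "us = filter (\<lambda>x. x < p) xs" and "vs = filter (\<lambda>x. p < x) xs"
  have sorted: "sorted_wrt (<) (us @ p # vs)"
    using assms(1) by (auto simp: us_def vs_def sorted_wrt_append sorted_wrt_filter)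
  then have "sorted_wrt (<) (us @ vs)"
    by (simp add: sorted_wrt_append)
  moreover have "set (us @ vs) = set xs"
    using p(3) by (auto simp: us_def vs_def) (metis linorder_neqE_nat)
  ultimately have eq: "xs = us @ vs"
    using assms(1) by (intro sorted_distinct_set_unique) (auto simp: strict_sorted_iff)
  have "hd xs \<in> set us" "last xs \<in> set vs"
    using p ne by (auto simp: us_def vs_def)
  then obtain a us' vs' b where "us = a # us'" "vs = vs' @ [b]"
    by (metis empty_iff list.exhaust list.set(1) rev_exhaust)
  then show ?thesis
    using that(2)[of a us' vs' b p] eq sorted by simp
qed

text \<open>
  Induction on the span \<open>last xs - hd xs\<close> of the rows: the three-term relation closes a gap
  at the price of a positive factor \<open>?D\<close> of order \<open>r\<close>. The relation \<open>rel\<close> lets one argument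
  cover nonnegativity and positivity: both are preserved by positive combinations and by division
  by a positive factor.
\<close>

lemma minors_from_consecutive_step:
  fixes M :: "nat \<Rightarrow> nat \<Rightarrow> 'c :: linordered_idom"
  assumes rel: "rel = (\<le>) \<or> rel = (<)"
    and lower: "\<And>xs ys. sorted_wrt (<) xs \<Longrightarrow> sorted_wrt (<) ys \<Longrightarrow> set ys \<subseteq> C \<Longrightarrow>
          length xs = r \<Longrightarrow> length ys = r \<Longrightarrow> 0 < minor M xs ys"
    and consecutive: "\<And>s ys. sorted_wrt (<) ys \<Longrightarrow> set ys \<subseteq> C \<Longrightarrow> length ys = Suc r \<Longrightarrow>
          rel 0 (minor M [s..<s + Suc r] ys)"
    and ys: "sorted_wrt (<) ys" "set ys \<subseteq> C" "length ys = Suc r"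
    and xs: "sorted_wrt (<) xs" "length xs = Suc r"
  shows "rel 0 (minor M xs ys)"
  using xs
proof (induction "last xs - hd xs" arbitrary: xs rule: less_induct)
  case less
  show ?case
  proof (rule consecutive_or_gap[OF less.prems])
    fix s assume "xs = [s..<s + Suc r]"
    then show ?thesis using consecutive ys by simp
  next
    fix a us p vs b
    assume xs: "xs = a # us @ vs @ [b]" and sorted: "sorted_wrt (<) (a # us @ p # vs @ [b])"
    let ?zs = "butlast ys"
    have len: "r = length us + length vs + 1"
      using less.prems xs by simp
    have "ys = ?zs @ [last ys]" using ys by (cases ys) auto
    then have zs: "sorted_wrt (<) ?zs" "set ?zs \<subseteq> set ys" "length ?zs = r"
      using ys(1,3) by (metis sorted_wrt_append, metis in_set_butlastD subsetI, simp)
    then have zsC: "set ?zs \<subseteq> C" using ys(2) by blast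
    let ?D = "minor M (us @ p # vs) ?zs"
    let ?x = "minor M (us @ vs @ [b]) ?zs" and ?y = "minor M (a # us @ vs) ?zs"
    have pos: "0 < ?D" "0 < ?x" "0 < ?y"
      using sorted len by (auto intro!: lower zs zsC simp: sorted_wrt_append)
    have "a < x \<and> x < b" if "x \<in> set (us @ p # vs)" for x
      using sorted that by (auto simp: sorted_wrt_append)
    from this[OF last_in_set] this[OF hd_in_set]
    have "a < last (us @ p # vs)" "last (us @ p # vs) < b"
        "a < hd (us @ p # vs)" "hd (us @ p # vs) < b"
      by simp_all
    moreover have "last (a # us @ p # vs) = last (us @ p # vs)"
        "hd (us @ p # vs @ [b]) = hd (us @ p # vs)" "last (us @ p # vs @ [b]) = b"
        "last xs = b" "hd xs = a"
      by (simp_all add: xs hd_append)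
    ultimately have span: "last (a # us @ p # vs) - hd (a # us @ p # vs) < last xs - hd xs"
        "last (us @ p # vs @ [b]) - hd (us @ p # vs @ [b]) < last xs - hd xs"
      by simp_all
    have "rel 0 (minor M (a # us @ p # vs) ys)"
      by (rule less.hyps[OF span(1)]) (use sorted len in \<open>auto simp: sorted_wrt_append\<close>)
    moreover have "rel 0 (minor M (us @ p # vs @ [b]) ys)"
      by (rule less.hyps[OF span(2)]) (use sorted len in \<open>auto simp: sorted_wrt_append\<close>)
    ultimately have "rel 0 (?D * minor M xs ys)"
      unfolding xs using three_term_relation[of ys us vs ?zs M p a b] ys(3) zs len rel pos
      by (auto intro!: add_nonneg_nonneg add_pos_pos)
    then show ?thesis
      using rel pos by (auto simp: zero_le_mult_iff zero_less_mult_iff)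
  qed
qed

text \<open>Induction on the order, which can start from the empty minor because its value is 1.\<close>

lemma minors_from_consecutive_pos:
  fixes M :: "nat \<Rightarrow> nat \<Rightarrow> 'c :: linordered_idom"
  assumes "\<And>r s ys. 1 \<le> r \<Longrightarrow> r \<le> k \<Longrightarrow> sorted_wrt (<) ys \<Longrightarrow> set ys \<subseteq> C \<Longrightarrow> length ys = r \<Longrightarrow>
          0 < minor M [s..<s + r] ys"
    and "r \<le> k" "sorted_wrt (<) xs" "sorted_wrt (<) ys" "set ys \<subseteq> C" "length xs = r" "length ys = r"
  shows "0 < minor M xs ys"
  using assms(2-)
proof (induction r arbitrary: xs ys)
  case 0
  then show ?case by (simp add: minor_def)
next
  case (Suc r)
  show ?case
    by (rule minors_from_consecutive_step[where rel = "(<)" and r = r and C = C])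
      (use Suc assms(1)[of "Suc r"] in auto)
qed

text \<open>
  Below order \<open>k\<close> everything is positive by the previous lemma, which is what the last step needs
  in order to pass \<open>rel\<close> from consecutive to arbitrary rows in order \<open>k\<close>.
\<close>

lemma minors_from_consecutive:
  fixes M :: "nat \<Rightarrow> nat \<Rightarrow> 'c :: linordered_idom"
  assumes rel: "rel = (\<le>) \<or> rel = (<)"
    and strict: "\<And>r s ys. 1 \<le> r \<Longrightarrow> r < k \<Longrightarrow> sorted_wrt (<) ys \<Longrightarrow> set ys \<subseteq> C \<Longrightarrow> length ys = r \<Longrightarrow>
          0 < minor M [s..<s + r] ys"
    and top: "\<And>s ys. sorted_wrt (<) ys \<Longrightarrow> set ys \<subseteq> C \<Longrightarrow> length ys = k \<Longrightarrow>
          rel 0 (minor M [s..<s + k] ys)"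
    and r: "1 \<le> r" "r \<le> k"
    and "sorted_wrt (<) xs" "sorted_wrt (<) ys" "set ys \<subseteq> C" "length xs = r" "length ys = r"
  shows "rel 0 (minor M xs ys)"
proof -
  obtain k' where k': "k = Suc k'" using r by (cases k) auto
  have lower: "0 < minor M xs ys" if "r \<le> k'" "sorted_wrt (<) xs" "sorted_wrt (<) ys" "set ys \<subseteq> C"
    "length xs = r" "length ys = r" for r xs ys
    by (rule minors_from_consecutive_pos[where k = k' and r = r and C = C])
      (use that strict k' in auto)
  show ?thesis
  proof (cases "r = k")
    case False
    then have "0 < minor M xs ys"
      using lower[of r] assms k' by simp
    then show ?thesis using rel by auto
  next
    case True
    show ?thesis
    proof (rule minors_from_consecutive_step[where r = k' and C = C, OF rel])
      show "0 < minor M xs ys" if "sorted_wrt (<) xs" "sorted_wrt (<) ys" "set ys \<subseteq> C"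
        "length xs = k'" "length ys = k'" for xs ys
        using lower[of k' xs ys] that by simp
    qed (use assms True k' in auto)
  qed
qed

section \<open>The Cauchy--Binet formula\<close>

text \<open>
  Each row of the product is a combination of rows of \<open>Y\<close>, so by
  multilinearity the determinant is a sum over all choices \<open>f\<close> of one row of \<open>Y\<close> per row of the
  product. Choices with a repetition contribute zero, and the others are grouped by their range
  \<open>K\<close>. Those with range \<open>K\<close> are the permutations of the increasing enumeration of \<open>K\<close>, and
  their signs assemble the minor of \<open>X\<close> with columns \<open>K\<close>.
\<close>

theorem det_cauchy_binet:
  fixes X Y :: "nat \<Rightarrow> nat \<Rightarrow> 'a :: comm_ring_1"
  shows "det (mat r r (\<lambda>(i, j). \<Sum>l<m. X i l * Y l j))
    = (\<Sum>K\<in>index_sets m r. det (mat r r (\<lambda>(i, j). X i (pick K j)))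
                          * det (mat r r (\<lambda>(i, j). Y (pick K i) j)))"
proof -
  let ?R = "{0..<r}"
  define F where "F = {f. (\<forall>i\<in>?R. f i \<in> {0..<m}) \<and> (\<forall>i. i \<notin> ?R \<longrightarrow> f i = i)}"
  define G where "G = {f \<in> F. inj_on f ?R}"
  define t where "t f = (\<Prod>i\<in>?R. X i (f i)) * det (mat r r (\<lambda>(i, j). Y (f i) j))" for f
  have finF: "finite F"
    unfolding F_def by (rule finite_bounded_functions) auto
  have "mat r r (\<lambda>(i, j). \<Sum>l<m. X i l * Y l j)
    = mat\<^sub>r r r (\<lambda>i. finsum_vec TYPE('a) r (\<lambda>l. X i l \<cdot>\<^sub>v vec r (Y l)) {0..<m})"
    by (intro eq_matI) (auto simp: index_finsum_vec atLeast0LessThan)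
  then have "det (mat r r (\<lambda>(i, j). \<Sum>l<m. X i l * Y l j))
    = (\<Sum>f\<in>F. det (mat\<^sub>r r r (\<lambda>i. X i (f i) \<cdot>\<^sub>v vec r (Y (f i)))))"
    unfolding F_def by (simp only:) (rule det_linear_rows_sum, auto)
  also have "\<dots> = sum t F"
  proof (rule sum.cong[OF refl])
    fix f
    have "det (mat\<^sub>r r r (\<lambda>i. X i (f i) \<cdot>\<^sub>v vec r (Y (f i))))
      = (\<Prod>i\<in>?R. X i (f i)) * det (mat\<^sub>r r r (\<lambda>i. vec r (Y (f i))))"
      by (rule det_rows_mul) auto
    also have "mat\<^sub>r r r (\<lambda>i. vec r (Y (f i))) = mat r r (\<lambda>(i, j). Y (f i) j)"
      by (intro eq_matI) auto
    finally show "det (mat\<^sub>r r r (\<lambda>i. X i (f i) \<cdot>\<^sub>v vec r (Y (f i)))) = t f"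
      by (simp add: t_def)
  qed
  \<comment> \<open>A choice that repeats a row of \<open>Y\<close> gives a determinant with two equal rows.\<close>
  also have "\<dots> = sum t G"
  proof (rule sum.mono_neutral_right[OF finF])
    show "\<forall>f\<in>F - G. t f = 0"
    proof
      fix f assume "f \<in> F - G"
      then obtain i j where "i < r" "j < r" "i \<noteq> j" "f i = f j"
        by (auto simp: G_def inj_on_def)
      then have "det (mat r r (\<lambda>(i, j). Y (f i) j)) = 0"
        by (intro det_identical_rows[of _ r i j]) auto
      then show "t f = 0"
        by (simp add: t_def)
    qed
  qed (auto simp: G_def)
  also have "\<dots> = (\<Sum>K\<in>index_sets m r. \<Sum>f\<in>{f \<in> G. f ` ?R = K}. t f)"
  proof (rule sum.group[symmetric])
    show "finite G" using finF by (simp add: G_def)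
    show "finite (index_sets m r)" by (simp add: index_sets_def)
    show "(\<lambda>f. f ` ?R) ` G \<subseteq> index_sets m r"
      by (auto simp: G_def F_def index_sets_def card_image)
  qed
  also have "\<dots> = (\<Sum>K\<in>index_sets m r. det (mat r r (\<lambda>(i, j). X i (pick K j)))
                          * det (mat r r (\<lambda>(i, j). Y (pick K i) j)))"
  proof (rule sum.cong[OF refl])
    fix K assume "K \<in> index_sets m r"
    then have K: "K \<subseteq> {0..<m}" "card K = r" and finK: "finite K"
      by (auto simp: index_sets_def finite_subset)
    let ?dY = "det (mat r r (\<lambda>(i, j). Y (pick K i) j))"
    have pickK: "pick K i \<in> K" if "i < r" for i
      using that K by (simp add: pick_in_set_le)
    \<comment> \<open>Injective choices with range \<open>K\<close> correspond to permutations: the rank of an element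
        in \<open>K\<close> inverts the enumeration \<open>pick K\<close>.\<close>
    define to_fun where "to_fun p = (\<lambda>i. if i < r then pick K (p i) else i)" for p
    define to_perm where "to_perm f = (\<lambda>i. if i < r then card {a \<in> K. a < f i} else i)" for f
    have "(\<Sum>f\<in>{f \<in> G. f ` ?R = K}. t f) = (\<Sum>p | p permutes ?R. t (to_fun p))"
    proof (rule sum.reindex_bij_witness[where i = to_fun and j = to_perm])
      fix f assume f: "f \<in> {f \<in> G. f ` ?R = K}"
      have mem: "f i \<in> K" if "i < r" for i
        using f that by auto
      have less: "card {a \<in> K. a < f i} < r" if "i < r" for i
        unfolding K(2)[symmetric] using mem[OF that] finK
        by (intro psubset_card_mono) auto
      show inv: "to_fun (to_perm f) = f"
        using f mem by (auto simp: to_fun_def to_perm_def pick_card_in_set G_def F_def)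
      have "inj_on (to_perm f) ?R"
      proof (rule inj_onI)
        fix i j assume ij: "i \<in> ?R" "j \<in> ?R" "to_perm f i = to_perm f j"
        then have "to_fun (to_perm f) i = to_fun (to_perm f) j"
          by (simp add: to_fun_def)
        then show "i = j"
          using ij f by (auto simp: inv G_def inj_on_def)
      qed
      moreover have "to_perm f ` ?R \<subseteq> ?R"
        using less by (auto simp: to_perm_def)
      ultimately have "bij_betw (to_perm f) ?R ?R"
        by (simp add: bij_betw_def endo_inj_surj)
      then show "to_perm f \<in> {p. p permutes ?R}"
        by (auto intro!: bij_imp_permutes simp: to_perm_def)
      show "t (to_fun (to_perm f)) = t f" by (simp add: inv)
    next
      fix p assume "p \<in> {p. p permutes ?R}"
      then have p: "p permutes ?R" by simp
      have less: "p i < r" if "i < r" for i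
        using permutes_in_image[OF p, of i] that by simp
      have out: "p i = i" if "\<not> i < r" for i
        using permutes_not_in[OF p, of i] that by simp
      show "to_perm (to_fun p) = p"
        using less out K by (auto simp: to_fun_def to_perm_def card_pick_le)
      have inj: "inj_on (to_fun p) ?R"
      proof (rule inj_onI)
        fix i j assume ij: "i \<in> ?R" "j \<in> ?R" "to_fun p i = to_fun p j"
        then have "pick K (p i) = pick K (p j)"
          by (simp add: to_fun_def)
        then have "p i = p j"
          using card_pick_le[of "p i" K] card_pick_le[of "p j" K] less[of i] less[of j] ij K(2)
          by (metis atLeastLessThan_iff)
        then show "i = j"
          using permutes_inj[OF p] by (simp add: inj_eq)
      qed
      have sub: "to_fun p ` ?R \<subseteq> K"
        using less pickK by (auto simp: to_fun_def)
      then have "to_fun p ` ?R = K"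
        using finK K(2) card_image[OF inj] by (intro card_subset_eq) auto
      moreover have "to_fun p \<in> G"
      proof -
        have "\<forall>i\<in>?R. to_fun p i \<in> {0..<m}"
          using sub K(1) by blast
        moreover have "\<forall>i. i \<notin> ?R \<longrightarrow> to_fun p i = i"
          by (simp add: to_fun_def)
        ultimately show ?thesis
          using inj by (simp add: G_def F_def)
      qed
      ultimately show "to_fun p \<in> {f \<in> G. f ` ?R = K}" by simp
    qed
    also have "\<dots> = (\<Sum>p | p permutes ?R. (signof p * (\<Prod>i\<in>?R. X i (pick K (p i)))) * ?dY)"
    proof (rule sum.cong[OF refl])
      fix p assume "p \<in> {p. p permutes ?R}"
      then have p: "p permutes ?R" by simp
      have less: "p i < r" if "i < r" for i
        using permutes_in_image[OF p, of i] that by simp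
      have "mat r r (\<lambda>(i, j). Y (to_fun p i) j)
        = mat r r (\<lambda>(i, j). mat r r (\<lambda>(i, j). Y (pick K i) j) $$ (p i, j))"
        using less by (intro eq_matI) (auto simp: to_fun_def)
      then have "det (mat r r (\<lambda>(i, j). Y (to_fun p i) j)) = signof p * ?dY"
        using det_permute_rows[OF mat_carrier p, of "\<lambda>(i, j). Y (pick K i) j"] by simp
      moreover have "(\<Prod>i\<in>?R. X i (to_fun p i)) = (\<Prod>i\<in>?R. X i (pick K (p i)))"
        by (intro prod.cong) (auto simp: to_fun_def)
      ultimately show "t (to_fun p) = (signof p * (\<Prod>i\<in>?R. X i (pick K (p i)))) * ?dY"
        by (simp add: t_def mult_ac)
    qed
    also have "\<dots> = (\<Sum>p | p permutes ?R. signof p * (\<Prod>i\<in>?R. X i (pick K (p i)))) * ?dY"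
      by (simp add: sum_distrib_right)
    also have "(\<Sum>p | p permutes ?R. signof p * (\<Prod>i\<in>?R. X i (pick K (p i))))
      = det (mat r r (\<lambda>(i, j). X i (pick K j)))"
    proof -
      have "(\<Prod>i\<in>?R. mat r r (\<lambda>(i, j). X i (pick K j)) $$ (i, p i))
        = (\<Prod>i\<in>?R. X i (pick K (p i)))" if "p permutes ?R" for p
        using permutes_in_image[OF that] by (intro prod.cong) auto
      then show ?thesis
        by (simp add: det_def'[of _ r])
    qed
    finally show "(\<Sum>f\<in>{f \<in> G. f ` ?R = K}. t f) = det (mat r r (\<lambda>(i, j). X i (pick K j))) * ?dY" .
  qed
  finally show ?thesis .
qed

section \<open>Compound matrices and index sets\<close>

lemma submatrix_index_sets:
  assumes "X \<in> carrier_mat p q" "I \<in> index_sets p r" "J \<in> index_sets q r"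
  shows "submatrix X I J = mat r r (\<lambda>(i, j). X $$ (pick I i, pick J j))"
proof -
  have "{i. i < p \<and> i \<in> I} = I" "{j. j < q \<and> j \<in> J} = J"
    using assms by (auto simp: index_sets_def)
  then show ?thesis
    using assms by (simp add: submatrix_def index_sets_def)
qed

lemma pick_index_sets: "I \<in> index_sets p r \<Longrightarrow> i < r \<Longrightarrow> pick I i < p"
  using pick_in_set_le[of i I] by (auto simp: index_sets_def)

lemma sorted_map_pick:
  "I \<in> index_sets p r \<Longrightarrow> sorted_wrt (<) (map (pick I) [0..<r])"
  by (auto simp: sorted_wrt_iff_nth_less index_sets_def pick_mono_le)

lemma map_pick_set:
  assumes "sorted_wrt (<) xs"
  shows "map (pick (set xs)) [0..<length xs] = xs"
proof -
  have card: "card (set xs) = length xs"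
    using assms by (simp add: strict_sorted_iff distinct_card)
  then have I: "set xs \<in> index_sets (Suc (Max (set xs))) (length xs)"
    by (auto simp: index_sets_def less_Suc_eq_le)
  have "set (map (pick (set xs)) [0..<length xs]) \<subseteq> set xs"
    using card by (auto intro: pick_in_set_le)
  moreover have "card (set (map (pick (set xs)) [0..<length xs])) = card (set xs)"
    using sorted_map_pick[OF I] card by (simp only: strict_sorted_iff distinct_card) simp
  ultimately have "set (map (pick (set xs)) [0..<length xs]) = set xs"
    by (intro card_subset_eq) auto
  then show ?thesis
    using assms sorted_map_pick[OF I]
    by (intro sorted_distinct_set_unique) (auto simp: strict_sorted_iff)
qed

lemma det_submatrix_eq_minor:
  assumes "X \<in> carrier_mat p q" "I \<in> index_sets p r" "J \<in> index_sets q r"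
    and "\<And>i j. i < p \<Longrightarrow> j < q \<Longrightarrow> X $$ (i, j) = M i j"
  shows "det (submatrix X I J) = minor M (map (pick I) [0..<r]) (map (pick J) [0..<r])"
proof -
  have "mat r r (\<lambda>(i, j). X $$ (pick I i, pick J j))
    = mat r r (\<lambda>(a, b). M (map (pick I) [0..<r] ! a) (map (pick J) [0..<r] ! b))"
    using assms pick_index_sets by (intro eq_matI) auto
  then show ?thesis
    by (simp add: submatrix_index_sets[OF assms(1-3)] minor_def)
qed

lemma index_list_nth: "i < n choose r \<Longrightarrow> index_list n r ! i \<in> index_sets n r"
  by (metis length_index_list nth_mem set_index_list)

lemma sum_index_list:
  "(\<Sum>i<n choose r. h (index_list n r ! i)) = (\<Sum>I\<in>index_sets n r. h I)"
  by (rule sum.reindex_bij_betw)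
    (simp add: bij_betw_nth distinct_index_list length_index_list set_index_list)

lemma dim_compound [simp]:
  "dim_row (compound r X) = dim_row X choose r" "dim_col (compound r X) = dim_col X choose r"
  by (simp_all add: compound_def)

text \<open>Cauchy--Binet, with the sum over index sets read as the inner sum of a matrix product.\<close>

theorem compound_mult:
  fixes X Y :: "'a :: comm_ring_1 mat"
  assumes X: "X \<in> carrier_mat p m" and Y: "Y \<in> carrier_mat m q"
  shows "compound r (X * Y) = compound r X * compound r Y"
proof (rule eq_matI)
  fix i j assume "i < dim_row (compound r X * compound r Y)" "j < dim_col (compound r X * compound r Y)"
  then have i: "i < p choose r" and j: "j < q choose r" using X Y by auto
  define I J where "I = index_list p r ! i" and "J = index_list q r ! j"
  have I: "I \<in> index_sets p r" and J: "J \<in> index_sets q r"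
    using i j by (simp_all add: I_def J_def index_list_nth)
  have "submatrix (X * Y) I J
    = mat r r (\<lambda>(a, b). \<Sum>l<m. X $$ (pick I a, l) * Y $$ (l, pick J b))"
    unfolding submatrix_index_sets[OF mult_carrier_mat[OF X Y] I J]
    using pick_index_sets[OF I] pick_index_sets[OF J] X Y
    by (intro eq_matI) (auto simp: scalar_prod_def atLeast0LessThan)
  then have "det (submatrix (X * Y) I J)
    = (\<Sum>K\<in>index_sets m r. det (submatrix X I K) * det (submatrix Y K J))"
    using det_cauchy_binet[where X = "\<lambda>a l. X $$ (pick I a, l)" and Y = "\<lambda>l b. Y $$ (l, pick J b)"]
    by (simp add: submatrix_index_sets[OF X I] submatrix_index_sets[OF Y _ J])
  also have "\<dots> = (\<Sum>l<m choose r. det (submatrix X I (index_list m r ! l))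
      * det (submatrix Y (index_list m r ! l) J))"
    by (rule sum_index_list[symmetric])
  finally show "compound r (X * Y) $$ (i, j) = (compound r X * compound r Y) $$ (i, j)"
    using X Y i j by (simp add: compound_def I_def J_def scalar_prod_def atLeast0LessThan)
qed (use X Y in auto)

lemma compound_mult_pow:
  fixes X A :: "'a :: comm_ring_1 mat"
  assumes X: "X \<in> carrier_mat p n" and A: "A \<in> carrier_mat n n"
  shows "compound r X * compound r A ^\<^sub>m s = compound r (X * A ^\<^sub>m s)"
proof (induction s)
  case 0
  have "compound r X \<in> carrier_mat (p choose r) (n choose r)"
    using X by (intro carrier_matI) auto
  then show ?case using X A by simp
next
  case (Suc s)
  have car: "compound r X \<in> carrier_mat (p choose r) (n choose r)"
      "compound r A \<in> carrier_mat (n choose r) (n choose r)"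
    using X A by (auto intro!: carrier_matI)
  have "compound r X * compound r A ^\<^sub>m Suc s = compound r X * compound r A ^\<^sub>m s * compound r A"
    using car by (simp add: assoc_mult_mat[OF _ pow_carrier_mat])
  also have "\<dots> = compound r (X * A ^\<^sub>m s * A)"
    using X A by (simp add: Suc.IH compound_mult[of "X * A ^\<^sub>m s" p n A n])
  also have "X * A ^\<^sub>m s * A = X * A ^\<^sub>m Suc s"
    using X A by (simp add: assoc_mult_mat[OF _ pow_carrier_mat])
  finally show ?case .
qed

lemma compound_full_order:
  assumes "X \<in> carrier_mat r r"
  shows "compound r X $$ (0, 0) = det X"
proof -
  have "index_list r r ! 0 \<in> index_sets r r"
    by (simp add: index_list_nth)
  then have "index_list r r ! 0 = {0..<r}"
    using card_subset_eq[of "{0..<r}" "index_list r r ! 0"] by (simp add: index_sets_def)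
  moreover have "submatrix X {0..<r} {0..<r} = X"
  proof -
    have "pick {0..<r} i = i" if "i < r" for i
      using map_pick_set[of "[0..<r]"] that by (simp add: list_eq_iff_nth_eq)
    then show ?thesis
      using assms by (subst submatrix_index_sets[OF assms]) (auto simp: index_sets_def intro!: eq_matI)
  qed
  ultimately show ?thesis
    using assms by (simp add: compound_def)
qed


section \<open>Markov parameters as minors of the observability matrix\<close>

text \<open>
  The entries of the infinite observability matrix; the matrices \<^const>\<open>obs_mat\<close> are its
  truncations, so minors of all of them can be treated together.
\<close>

definition obs_entry :: "real mat \<Rightarrow> real mat \<Rightarrow> nat \<Rightarrow> nat \<Rightarrow> real" where
  "obs_entry A c t j = (c * A ^\<^sub>m t) $$ (0, j)"

lemma obs_mat_carrier: "A \<in> carrier_mat n n \<Longrightarrow> obs_mat A c t \<in> carrier_mat t n"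
  by (auto simp: obs_mat_def)

lemma obs_mat_index:
  assumes "A \<in> carrier_mat n n" "c \<in> carrier_mat 1 n" "i < t" "j < n"
  shows "obs_mat A c t $$ (i, j) = obs_entry A c i j"
  using assms by (simp add: obs_mat_def mat_of_rows_index obs_entry_def)

text \<open>Multiplication by \<open>A\<^sup>s\<close> on the right shifts time by \<open>s\<close>, since \<open>c A\<^sup>i A\<^sup>s = c A\<^sup>s\<^sup>+\<^sup>i\<close>.\<close>

lemma obs_mat_mult_pow_index:
  assumes A: "A \<in> carrier_mat n n" and c: "c \<in> carrier_mat 1 n" and ij: "i < t" "j < n"
  shows "(obs_mat A c t * A ^\<^sub>m s) $$ (i, j) = obs_entry A c (s + i) j"
proof -
  have "row (obs_mat A c t) i = row (c * A ^\<^sub>m i) 0"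
  proof (rule eq_vecI)
    show "dim_vec (row (obs_mat A c t) i) = dim_vec (row (c * A ^\<^sub>m i) 0)"
      using A obs_mat_carrier[OF A, of c t] by simp
    fix l assume "l < dim_vec (row (c * A ^\<^sub>m i) 0)"
    then have "l < n" using A by (simp split: if_splits)
    then show "row (obs_mat A c t) i $ l = row (c * A ^\<^sub>m i) 0 $ l"
      using A c ij obs_mat_carrier[OF A, of c t]
      by (simp add: obs_mat_index obs_entry_def del: index_mult_mat(1))
  qed
  then have "(obs_mat A c t * A ^\<^sub>m s) $$ (i, j) = (c * A ^\<^sub>m i * A ^\<^sub>m s) $$ (0, j)"
    using assms obs_mat_carrier[OF A, of c t] by simp
  also have "c * A ^\<^sub>m i * A ^\<^sub>m s = c * A ^\<^sub>m (s + i)"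
  proof (induction s)
    case 0
    then show ?case using A c by simp
  next
    case (Suc s)
    have "c * A ^\<^sub>m i * A ^\<^sub>m Suc s = c * A ^\<^sub>m i * A ^\<^sub>m s * A"
      unfolding pow_mat.simps
      by (rule assoc_mult_mat[symmetric, of _ 1 n _ n _ n]) (use A c in auto)
    also have "\<dots> = c * A ^\<^sub>m (Suc s + i)"
      unfolding Suc.IH using A c by (simp add: assoc_mult_mat[of _ 1 n _ n _ n])
    finally show ?case .
  qed
  finally show ?thesis by (simp add: obs_entry_def)
qed

lemma col_selector_carrier:
  assumes "J \<in> index_sets n r"
  shows "col_selector n J \<in> carrier_mat n r"
proof -
  have "{i. i < n \<and> i \<in> {0..<n}} = {0..<n}" "{j. j < n \<and> j \<in> J} = J"
    using assms by (auto simp: index_sets_def)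
  then show ?thesis
    using assms by (intro carrier_matI) (simp_all add: col_selector_def dim_submatrix index_sets_def)
qed

lemma mult_col_selector:
  assumes X: "X \<in> carrier_mat p n" and J: "J \<in> index_sets n r"
  shows "X * col_selector n J = mat p r (\<lambda>(i, j). X $$ (i, pick J j))"
proof -
  have pick: "pick {0..<n} i = i" if "i < n" for i
    using map_pick_set[of "[0..<n]"] that by (simp add: list_eq_iff_nth_eq)
  have "{j. j < n \<and> j \<in> J} = J"
    using J by (auto simp: index_sets_def)
  then have sel: "col_selector n J = mat n r (\<lambda>(i, j). if i = pick J j then 1 else 0)"
    using J pick_index_sets[OF J]
    by (intro eq_matI) (auto simp: col_selector_def submatrix_def index_sets_def pick)
  have "(\<Sum>l = 0..<n. X $$ (i, l) * (if l = pick J j then 1 else 0)) = X $$ (i, pick J j)"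
    if "j < r" for i j
    using pick_index_sets[OF J that] by (simp add: if_distrib cong: if_cong)
  then show ?thesis
    using X by (intro eq_matI) (auto simp: sel scalar_prod_def)
qed

text \<open>
  Both factors of \<^const>\<open>b_tilde\<close> combine into the compound of
  \<open>(\<O>\<^sup>n)\<^sup>-\<^sup>1 (\<O>\<^sup>n P\<^sub>\<beta>) = P\<^sub>\<beta>\<close>. This is where observability enters.
\<close>

lemma b_tilde_eq_compound:
  assumes A: "A \<in> carrier_mat n n" and obs: "observable A c" and J: "J \<in> index_sets n r"
  shows "b_tilde A c r J = compound r (col_selector n J)"
proof -
  let ?M = "obs_mat A c n"
  let ?N = "the (mat_inverse ?M)"
  note M = obs_mat_carrier[OF A, of c n]
  have inv: "?N \<in> carrier_mat n n" "?N * ?M = 1\<^sub>m n"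
    using mat_inverse_invertible[OF M] obs A by (auto simp: observable_def)
  note P = col_selector_carrier[OF J]
  have "b_tilde A c r J = compound r ?N * compound r (?M * col_selector n J)"
    using A by (simp add: b_tilde_def Let_def)
  also have "\<dots> = compound r (?N * (?M * col_selector n J))"
    by (rule compound_mult[symmetric]) (use inv M P in auto)
  also have "?N * (?M * col_selector n J) = col_selector n J"
    using inv M P by (simp add: assoc_mult_mat[symmetric])
  finally show ?thesis .
qed

text \<open>
  The product of the three compounds is the \<open>r\<close>-th compound of the \<open>r \<times> r\<close> matrix
  \<open>\<O>\<^sup>r A\<^sup>s P\<^sub>J\<close>, whose only entry is its determinant; the columns are selected by \<open>P\<^sub>J\<close> and
  the rows are the observability rows with indices \<open>s, \<dots>, s + r - 1\<close>.
\<close>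

lemma markov_parameter_eq_minor:
  assumes A: "A \<in> carrier_mat n n" and c: "c \<in> carrier_mat 1 n" and obs: "observable A c"
    and J: "J \<in> index_sets n r"
  shows "(c_tilde A c r * A_tilde A r ^\<^sub>m s * b_tilde A c r J) $$ (0, 0)
    = minor (obs_entry A c) [s..<s + r] (map (pick J) [0..<r])"
proof -
  let ?X = "obs_mat A c r * A ^\<^sub>m s"
  have X: "?X \<in> carrier_mat r n"
    by (rule mult_carrier_mat[OF obs_mat_carrier[OF A] pow_carrier_mat[OF A]])
  note P = col_selector_carrier[OF J]
  have "c_tilde A c r * A_tilde A r ^\<^sub>m s * b_tilde A c r J
    = compound r ?X * compound r (col_selector n J)"
    by (simp add: c_tilde_def A_tilde_def b_tilde_eq_compound[OF A obs J]
        compound_mult_pow[OF obs_mat_carrier[OF A] A])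
  also have "\<dots> = compound r (?X * col_selector n J)"
    by (rule compound_mult[OF X P, symmetric])
  finally have "(c_tilde A c r * A_tilde A r ^\<^sub>m s * b_tilde A c r J) $$ (0, 0)
    = det (?X * col_selector n J)"
    using compound_full_order[of "?X * col_selector n J" r] X P by simp
  also have "?X * col_selector n J
    = mat r r (\<lambda>(i, j). obs_entry A c ([s..<s + r] ! i) (map (pick J) [0..<r] ! j))"
    unfolding mult_col_selector[OF X J]
    by (intro eq_matI) (auto simp: obs_mat_mult_pow_index[OF A c] pick_index_sets[OF J]
        simp del: index_mult_mat)
  finally show ?thesis
    by (simp add: minor_def)
qed

theorem corollary4:
  fixes A c :: "real mat" and n k :: nat
  assumes "A \<in> carrier_mat n n" and "c \<in> carrier_mat 1 n"
    and "observable A c"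
    and "k \<in> {1..n}"
    and "\<forall>r\<in>{1..k - 1}. \<forall>\<beta>\<in>index_sets n r.
           strictly_externally_positive (A_tilde A r) (b_tilde A c r \<beta>) (c_tilde A c r)"
  shows "((\<forall>\<beta>\<in>index_sets n k.
             externally_positive (A_tilde A k) (b_tilde A c k \<beta>) (c_tilde A c k))
           \<longrightarrow> obs_op_k_positive k A c)
       \<and> ((\<forall>\<beta>\<in>index_sets n k.
             strictly_externally_positive (A_tilde A k) (b_tilde A c k \<beta>) (c_tilde A c k))
           \<longrightarrow> obs_op_strictly_k_positive k A c)"
proof -
  note A = assms(1) and c = assms(2) and obs = assms(3)
  let ?M = "obs_entry A c"
  have consecutive: "(c_tilde A c r * A_tilde A r ^\<^sub>m s * b_tilde A c r (set ys)) $$ (0, 0)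
      = minor ?M [s..<s + r] ys" "set ys \<in> index_sets n r"
    if "sorted_wrt (<) ys" "set ys \<subseteq> {0..<n}" "length ys = r" for r s ys
  proof -
    show "set ys \<in> index_sets n r"
      using that by (auto simp: index_sets_def strict_sorted_iff distinct_card)
    then show "(c_tilde A c r * A_tilde A r ^\<^sub>m s * b_tilde A c r (set ys)) $$ (0, 0)
      = minor ?M [s..<s + r] ys"
      using markov_parameter_eq_minor[OF A c obs] map_pick_set[OF that(1)] that(3) by simp
  qed
  \<comment> \<open>Times are counted from 1 in the definition of external positivity, hence \<open>Suc s\<close>.\<close>
  have strict: "0 < minor ?M [s..<s + r] ys"
    if "strictly_externally_positive (A_tilde A r) (b_tilde A c r (set ys)) (c_tilde A c r)"
      "sorted_wrt (<) ys" "set ys \<subseteq> {0..<n}" "length ys = r" for r s ys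
    using that(1) consecutive(1)[OF that(2-), of s]
    by (auto simp: strictly_externally_positive_def dest!: spec[of _ "Suc s"])
  have weak: "0 \<le> minor ?M [s..<s + r] ys"
    if "externally_positive (A_tilde A r) (b_tilde A c r (set ys)) (c_tilde A c r)"
      "sorted_wrt (<) ys" "set ys \<subseteq> {0..<n}" "length ys = r" for r s ys
    using that(1) consecutive(1)[OF that(2-), of s]
    by (auto simp: externally_positive_def dest!: spec[of _ "Suc s"])
  have lower: "0 < minor ?M [s..<s + r] ys"
    if "1 \<le> r" "r < k" "sorted_wrt (<) ys" "set ys \<subseteq> {0..<n}" "length ys = r" for r s ys
    using strict[OF _ that(3-)] assms(5) consecutive(2)[OF that(3-)] that(1,2) by simp
  have all_minors: "rel 0 (det (submatrix (obs_mat A c t) I J))"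
    if rel: "rel = (\<le>) \<or> rel = (<)"
      and top: "\<And>s ys. sorted_wrt (<) ys \<Longrightarrow> set ys \<subseteq> {0..<n} \<Longrightarrow> length ys = k \<Longrightarrow>
          rel 0 (minor ?M [s..<s + k] ys)"
      and IJ: "1 \<le> j" "j \<le> k" "I \<in> index_sets t j" "J \<in> index_sets n j" for rel t j I J
  proof -
    have "rel 0 (minor ?M (map (pick I) [0..<j]) (map (pick J) [0..<j]))"
      by (rule minors_from_consecutive[OF rel lower top IJ(1,2)])
        (use IJ in \<open>auto simp: sorted_map_pick pick_index_sets\<close>)
    then show ?thesis
      using det_submatrix_eq_minor[OF obs_mat_carrier[OF A] IJ(3,4)] obs_mat_index[OF A c] by simp
  qed
  have dim: "dim_row (obs_mat A c t) = t" "dim_col (obs_mat A c t) = n" for t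
    using obs_mat_carrier[OF A, of c t] by auto
  have "obs_op_k_positive k A c"
    if "\<forall>\<beta>\<in>index_sets n k. externally_positive (A_tilde A k) (b_tilde A c k \<beta>) (c_tilde A c k)"
    unfolding obs_op_k_positive_def k_positive_def dim
    using all_minors[of "(\<le>)"] weak[of k] consecutive(2)[of _ k] that assms(4) by auto
  moreover have "obs_op_strictly_k_positive k A c"
    if "\<forall>\<beta>\<in>index_sets n k.
      strictly_externally_positive (A_tilde A k) (b_tilde A c k \<beta>) (c_tilde A c k)"
    unfolding obs_op_strictly_k_positive_def strictly_k_positive_def dim
    using all_minors[of "(<)"] strict[of k] consecutive(2)[of _ k] that assms(4) by auto
  ultimately show ?thesis by blast
qed

end
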